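(* Let $\omega_0>0$. Consider the planar steering-controlled vehicle $$\tfrac{d}{dt}Q=Q\,Q_{\frac{\pi}{2}}\,\omega,\qquad \tfrac{d}{dt}p=Q\,v,$$ with position $p(t)\in\mathbb{R}^2$, orientation $Q(t)\in SO(2)$ and fixed body-frame velocity $v=|v|\,Q_\phi\mathbf{e}_1$, $|v|>0$, and a reference $(p_r(t),Q_r(t))$ satisfying $\tfrac{d}{dt}Q_r=Q_rQ_{\frac{\pi}{2}}\omega_0$, $\tfrac{d}{dt}p_r=Q_r\mathbf{e}_1$. Apply the controller $$\omega=\omega_0+\omega_P-k_I\omega_I,\qquad \tfrac{d}{dt}\omega_I=\omega_P-k_I\omega_I,$$ $$\omega_P=k_P\,\mathbf{e}_1^T\left(\omega_0\,Q^T(p-p_r)-Q^TQ_r\,Q_{\frac{\pi}{2}}\mathbf{e}_1\right).$$ Then for any $|v|>0$ and any misalignment $\phi\in(-\tfrac{\pi}{2},\tfrac{\pi}{2})$, there exist $k_I>0$ and $k_P>0$ small enough such that the target situation, with $\omega=\omega_0$ and $c=c_r$, is locally asymptotically stable for the closed-loop system.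
   Context: $\mathbf{e}_1=[1,0]^T$; $Q_{\frac{\pi}{2}}$ and $Q_\phi$ are the $2\times2$ matrices of rotation by $\pi/2$ and by $\phi$ in the plane. The nominal velocity is $v_r=\mathbf{e}_1$, and $\phi$ is the angle of misalignment of the actual velocity $v$ with respect to it. The vehicle's instantaneous circle center is $c(t)=p(t)+\tfrac{1}{\omega_0}Q_{\frac{\pi}{2}}Q(t)v$, and the (constant) reference circle center is $c_r=p_r(t)+\tfrac{1}{\omega_0}Q_{\frac{\pi}{2}}Q_r(t)\mathbf{e}_1$. Local asymptotic stability of the target situation means: for every $\delta>0$ there is $\eta>0$ such that $|c(0)-c_r|+|\omega(0)-\omega_0|<\eta$ implies $|c(t)-c_r|+|\omega(t)-\omega_0|<\delta$ for all $t\ge0$, and for $\eta$ small enough it also implies $c(t)\to c_r$ and $\omega(t)\to\omega_0$ as $t\to\infty$. Equivalently, it is local asymptotic stability of the corresponding equilibrium in the variables $(Q^T(c-c_r),\omega_I)\in\mathbb{R}^2\times\mathbb{R}$, in which the closed-loop dynamics are autonomous. *)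

theory Defs
  imports "HOL-Analysis.Analysis"
begin

definition e1 :: "real^2" where
  "e1 = axis 1 1"

definition rot :: "real \<Rightarrow> real^2^2" where
  "rot \<theta> = vector [vector [cos \<theta>, - sin \<theta>], vector [sin \<theta>, cos \<theta>]]"

definition circle_center :: "real \<Rightarrow> real^2 \<Rightarrow> real^2 \<Rightarrow> real^2^2 \<Rightarrow> real^2" where
  "circle_center \<omega>0 v p Q = p + (1 / \<omega>0) *\<^sub>R ((rot (pi/2) ** Q) *v v)"

definition steered_motion ::
    "real^2 \<Rightarrow> (real \<Rightarrow> real) \<Rightarrow> (real \<Rightarrow> real^2) \<Rightarrow> (real \<Rightarrow> real^2^2) \<Rightarrow> bool" where
  "steered_motion v \<omega> p Q \<longleftrightarrow>
    (\<forall>t\<ge>0. rotation_matrix (Q t) \<and>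
      (Q has_vector_derivative \<omega> t *\<^sub>R (Q t ** rot (pi/2))) (at t within {0..}) \<and>
      (p has_vector_derivative Q t *v v) (at t within {0..}))"

definition \<omega>P ::
    "real \<Rightarrow> real \<Rightarrow> real^2 \<Rightarrow> real^2^2 \<Rightarrow> real^2 \<Rightarrow> real^2^2 \<Rightarrow> real" where
  "\<omega>P \<omega>0 kP pr Qr p Q =
    kP * (e1 \<bullet> (\<omega>0 *\<^sub>R (transpose Q *v (p - pr)) - (transpose Q ** Qr ** rot (pi/2)) *v e1))"

definition \<omega>ctrl ::
    "real \<Rightarrow> real \<Rightarrow> real \<Rightarrow> real^2 \<Rightarrow> real^2^2 \<Rightarrow> real^2 \<Rightarrow> real^2^2 \<Rightarrow> real \<Rightarrow> real" where
  "\<omega>ctrl \<omega>0 kP kI pr Qr p Q \<omega>I = \<omega>0 + \<omega>P \<omega>0 kP pr Qr p Q - kI * \<omega>I"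

text \<open>Solutions are taken on the whole half-line \<open>t \<ge> 0\<close>. This loses nothing: \<open>Q\<close> is
  bounded, so \<open>p\<close> and \<open>\<omega>I\<close> grow at most linearly and exponentially, respectively, and no
  solution escapes in finite time.\<close>

definition closed_loop ::
    "real \<Rightarrow> real^2 \<Rightarrow> real \<Rightarrow> real \<Rightarrow> (real \<Rightarrow> real^2) \<Rightarrow> (real \<Rightarrow> real^2^2) \<Rightarrow>
     (real \<Rightarrow> real^2) \<Rightarrow> (real \<Rightarrow> real^2^2) \<Rightarrow> (real \<Rightarrow> real) \<Rightarrow> bool" where
  "closed_loop \<omega>0 v kP kI pr Qr p Q \<omega>I \<longleftrightarrow>
    steered_motion v (\<lambda>t. \<omega>ctrl \<omega>0 kP kI (pr t) (Qr t) (p t) (Q t) (\<omega>I t)) p Q \<and>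
    (\<forall>t\<ge>0. (\<omega>I has_real_derivative \<omega>P \<omega>0 kP (pr t) (Qr t) (p t) (Q t) - kI * \<omega>I t)
      (at t within {0..}))"

text \<open>The reference center is constant along a reference motion, so comparing the two centers
  at the same time \<open>t\<close> is comparing with that fixed point. The initial value of \<open>\<omega>I\<close> is not
  constrained separately: for \<open>kI \<noteq> 0\<close> it is determined by \<open>\<omega>\<close> and \<open>Q\<^sup>T (c - c\<^sub>r)\<close>.\<close>

definition target_locally_asymptotically_stable ::
    "real \<Rightarrow> real^2 \<Rightarrow> real \<Rightarrow> real \<Rightarrow> (real \<Rightarrow> real^2) \<Rightarrow> (real \<Rightarrow> real^2^2) \<Rightarrow> bool" where
  "target_locally_asymptotically_stable \<omega>0 v kP kI pr Qr \<longleftrightarrow>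
    (let c = (\<lambda>p Q t. circle_center \<omega>0 v (p t) (Q t));
         cr = (\<lambda>t. circle_center \<omega>0 e1 (pr t) (Qr t));
         \<omega> = (\<lambda>p Q \<omega>I t. \<omega>ctrl \<omega>0 kP kI (pr t) (Qr t) (p t) (Q t) (\<omega>I t));
         dev = (\<lambda>p Q \<omega>I t. norm (c p Q t - cr t) + \<bar>\<omega> p Q \<omega>I t - \<omega>0\<bar>)
     in (\<forall>\<delta>>0. \<exists>\<eta>>0. \<forall>p Q \<omega>I. closed_loop \<omega>0 v kP kI pr Qr p Q \<omega>I \<longrightarrow>
           dev p Q \<omega>I 0 < \<eta> \<longrightarrow> (\<forall>t\<ge>0. dev p Q \<omega>I t < \<delta>)) \<and>
        (\<exists>\<eta>>0. \<forall>p Q \<omega>I. closed_loop \<omega>0 v kP kI pr Qr p Q \<omega>I \<longrightarrow>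
           dev p Q \<omega>I 0 < \<eta> \<longrightarrow>
             ((\<lambda>t. c p Q t - cr t) \<longlongrightarrow> 0) at_top \<and> (\<omega> p Q \<omega>I \<longlongrightarrow> \<omega>0) at_top))"

end

theory Submission
  imports Defs
begin

text \<open>In the body frame, the error \<open>\<zeta> = Q\<^sup>T (c - c\<^sub>r)\<close> and \<open>w = \<omega> - \<omega>0\<close> obey an autonomous quadratic
  system in three variables. With \<open>d = kP * v\<^sub>1 + kI\<close>, its linearization at the origin has characteristic
  polynomial \<open>\<lambda>\<^sup>3 + d \<lambda>\<^sup>2 + (\<omega>0\<^sup>2 + kP * \<omega>0 * v\<^sub>2) \<lambda> + \<omega>0\<^sup>2 * kI\<close>, and the Routh-Hurwitz condition reduces to
  \<open>\<omega>0 * v\<^sub>1 + v\<^sub>2 * d > 0\<close>, which holds for small gains because \<open>v\<^sub>1 > 0\<close>. In coordinates that bring the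
  linearization to Schwarz form, an explicit quadratic Lyapunov function gives local exponential decay
  of the quadratic system. Since \<open>Q\<close> is a rotation, \<open>\<zeta>\<close> and \<open>c - c\<^sub>r\<close> have the same norm.\<close>

section \<open>Quadratic Lyapunov functions and local exponential decay\<close>

text \<open>For \<open>x' = y\<close>, \<open>y' = z - b1 * x\<close>, \<open>z' = - b2 * y - a * z\<close>, the form \<open>b1 * b2 * x\<^sup>2 + b2 * y\<^sup>2 + z\<^sup>2\<close> has
  derivative \<open>- 2 * a * z\<^sup>2\<close>, which is only semidefinite; the small cross terms add \<open>- \<epsilon> * b2 * y\<^sup>2\<close> and
  \<open>- \<epsilon> * b1 * b2 * x\<^sup>2\<close> to it.\<close>

lemma schwarz_lyapunov:
  fixes a b1 b2 :: real
  assumes "a > 0" "b1 > 0" "b2 > 0"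
  obtains \<epsilon> m M \<mu> where "\<epsilon> > 0" "m > 0" "M > 0" "\<mu> > 0"
    and "\<And>x y z. m * (x\<^sup>2 + y\<^sup>2 + z\<^sup>2) \<le> b1*b2*x\<^sup>2 + b2*y\<^sup>2 + z\<^sup>2 + \<epsilon> * (2*y*z + b2*x*y)"
    and "\<And>x y z. b1*b2*x\<^sup>2 + b2*y\<^sup>2 + z\<^sup>2 + \<epsilon> * (2*y*z + b2*x*y) \<le> M * (x\<^sup>2 + y\<^sup>2 + z\<^sup>2)"
    and "\<And>x y z. (2*b1*b2*x + \<epsilon>*b2*y) * y + (2*b2*y + \<epsilon>*(2*z + b2*x)) * (z - b1*x)
            + (2*z + 2*\<epsilon>*y) * (- b2*y - a*z) \<le> - \<mu> * (x\<^sup>2 + y\<^sup>2 + z\<^sup>2)"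
proof -
  define m where "m = min (b1*b2) (min b2 1)"
  \<comment> \<open>\<open>S\<close> is the total weight of \<open>z\<^sup>2\<close> inside the
    factor of \<open>\<epsilon>\<close>: 2 from the derivative of \<open>2*y*z\<close>, and one
    remainder from each of the completed squares \<open>y1\<close> and \<open>y2\<close>. The first
    bound in \<open>\<epsilon>\<close> gives \<open>\<epsilon> * S \<le> a\<close>, so that half of
    the dissipation \<open>2*a*z\<^sup>2\<close> survives; the second keeps the cross terms below
    half of the definite form.\<close>
  define S where "S = 2 + (b2 - 2*b1)\<^sup>2 / (2*b1*b2) + 2*a\<^sup>2/b2"
  define \<epsilon> where "\<epsilon> = min (a / S) (m / (2*(1 + b2)))"
  define \<mu> where "\<mu> = min a (\<epsilon> * min (b1*b2/2) (b2/2))"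
  have m: "m > 0" "m \<le> b1*b2" "m \<le> b2" "m \<le> 1"
    using assms by (auto simp: m_def)
  have S: "S > 0"
    using assms by (auto simp: S_def intro!: add_pos_nonneg)
  have \<epsilon>: "\<epsilon> > 0" using assms m S by (auto simp: \<epsilon>_def)
  have "\<epsilon> \<le> a / S" "\<epsilon> \<le> m / (2*(1 + b2))" by (auto simp: \<epsilon>_def)
  then have \<epsilon>S: "\<epsilon> * S \<le> a" and \<epsilon>m: "\<epsilon> * (1 + b2) \<le> m / 2"
    using S assms by (auto simp: field_simps)
  have \<mu>: "\<mu> > 0" using assms \<epsilon> by (auto simp: \<mu>_def)
  have cross: "\<bar>\<epsilon> * (2*y*z + b2*x*y)\<bar> \<le> m / 2 * (x\<^sup>2 + y\<^sup>2 + z\<^sup>2)" for x y z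
  proof -
    have yz: "\<bar>2*y*z\<bar> \<le> x\<^sup>2 + y\<^sup>2 + z\<^sup>2"
      using sum_squares_bound[of "\<bar>y\<bar>" "\<bar>z\<bar>"] zero_le_power2[of x]
      unfolding abs_mult power2_abs by (simp add: add.assoc add_increasing)
    have "\<bar>x*y\<bar> \<le> x\<^sup>2 + y\<^sup>2 + z\<^sup>2"
      using sum_squares_bound[of "\<bar>x\<bar>" "\<bar>y\<bar>"] zero_le_power2[of z] zero_le_power2[of x] zero_le_power2[of y]
        abs_ge_zero[of "x*y"]
      unfolding abs_mult power2_abs by linarith
    then have "\<bar>b2*x*y\<bar> \<le> b2 * (x\<^sup>2 + y\<^sup>2 + z\<^sup>2)"
      using assms(3) by (simp add: abs_mult mult.assoc)
    with yz have "\<bar>2*y*z + b2*x*y\<bar> \<le> (1 + b2) * (x\<^sup>2 + y\<^sup>2 + z\<^sup>2)"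
      by (simp add: algebra_simps)
    then have "\<epsilon> * \<bar>2*y*z + b2*x*y\<bar> \<le> \<epsilon> * (1 + b2) * (x\<^sup>2 + y\<^sup>2 + z\<^sup>2)"
      using \<epsilon> by (simp add: mult.assoc)
    also have "\<dots> \<le> m / 2 * (x\<^sup>2 + y\<^sup>2 + z\<^sup>2)"
      by (intro mult_right_mono \<epsilon>m) auto
    finally show ?thesis using \<epsilon> by (simp add: abs_mult)
  qed
  show ?thesis
  proof (rule that[of \<epsilon> "m/2" "b1*b2 + b2 + 1 + m/2" \<mu>])
    fix x y z :: real
    let ?N = "x\<^sup>2 + y\<^sup>2 + z\<^sup>2"
    have "m * x\<^sup>2 \<le> b1*b2*x\<^sup>2" "m * y\<^sup>2 \<le> b2*y\<^sup>2" "m * z\<^sup>2 \<le> 1 * z\<^sup>2"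
      using m by (intro mult_right_mono; simp)+
    then have "m * ?N \<le> b1*b2*x\<^sup>2 + b2*y\<^sup>2 + z\<^sup>2" by (simp add: algebra_simps)
    with cross[of y z x]
    show "m/2 * ?N \<le> b1*b2*x\<^sup>2 + b2*y\<^sup>2 + z\<^sup>2 + \<epsilon> * (2*y*z + b2*x*y)"
      by (simp add: algebra_simps)
    have "b1*b2*x\<^sup>2 \<le> b1*b2*?N" "b2*y\<^sup>2 \<le> b2*?N" "z\<^sup>2 \<le> ?N"
      using assms by (auto intro!: mult_left_mono)
    with cross[of y z x]
    show "b1*b2*x\<^sup>2 + b2*y\<^sup>2 + z\<^sup>2 + \<epsilon> * (2*y*z + b2*x*y) \<le> (b1*b2 + b2 + 1 + m/2) * ?N"
      by (simp only: distrib_right mult_1)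
    \<comment> \<open>Young's inequality with the weights chosen so that exactly half of the new
      \<open>x\<^sup>2\<close> term is spent and the rest goes to \<open>z\<^sup>2\<close>;
      \<open>y2\<close> does the same for \<open>y\<^sup>2\<close>.\<close>
    have y1: "(b2 - 2*b1) * x * z \<le> b1*b2/2 * x\<^sup>2 + (b2 - 2*b1)\<^sup>2/(2*b1*b2) * z\<^sup>2"
    proof -
      have "0 \<le> (b1*b2*x - (b2 - 2*b1) * z)\<^sup>2 / (2*b1*b2)" using assms by simp
      also have "\<dots> = b1*b2/2 * x\<^sup>2 + (b2 - 2*b1)\<^sup>2/(2*b1*b2) * z\<^sup>2 - (b2 - 2*b1) * x * z"
        using assms by (simp add: field_simps power2_eq_square)
      finally show ?thesis by simp
    qed
    have y2: "- 2*a*y*z \<le> b2/2 * y\<^sup>2 + 2*a\<^sup>2/b2 * z\<^sup>2"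
    proof -
      have "0 \<le> (b2*y + 2*a*z)\<^sup>2 / (2*b2)" using assms by simp
      also have "\<dots> = b2/2 * y\<^sup>2 + 2*a\<^sup>2/b2 * z\<^sup>2 + 2*a*y*z"
        using assms by (simp add: field_simps power2_eq_square)
      finally show ?thesis by simp
    qed
    have "(2*b1*b2*x + \<epsilon>*b2*y) * y + (2*b2*y + \<epsilon>*(2*z + b2*x)) * (z - b1*x) + (2*z + 2*\<epsilon>*y) * (- b2*y - a*z)
      = - 2*a*z\<^sup>2 + \<epsilon> * (2*z\<^sup>2 - b2*y\<^sup>2 - b1*b2*x\<^sup>2 + (b2 - 2*b1)*x*z + (- 2*a*y*z))"
      by (simp add: algebra_simps power2_eq_square)
    also have "\<dots> \<le> - 2*a*z\<^sup>2 + \<epsilon> * (S * z\<^sup>2 - (b1*b2/2 * x\<^sup>2 + b2/2 * y\<^sup>2))"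
    proof -
      have "2*z\<^sup>2 - b2*y\<^sup>2 - b1*b2*x\<^sup>2 + (b2 - 2*b1)*x*z + (- 2*a*y*z)
        \<le> S * z\<^sup>2 - (b1*b2/2 * x\<^sup>2 + b2/2 * y\<^sup>2)"
        unfolding S_def distrib_right using y1 y2 by simp
      then show ?thesis using \<epsilon> by simp
    qed
    also have "\<dots> \<le> - a*z\<^sup>2 - \<epsilon> * (b1*b2/2 * x\<^sup>2 + b2/2 * y\<^sup>2)"
      using mult_right_mono[OF \<epsilon>S zero_le_power2[of z]] by (simp add: algebra_simps)
    also have "\<dots> \<le> - \<mu> * ?N"
    proof -
      have "\<mu> \<le> \<epsilon> * min (b1*b2/2) (b2/2)" by (simp add: \<mu>_def)
      moreover have "\<epsilon> * min (b1*b2/2) (b2/2) \<le> \<epsilon> * (b1*b2/2)" "\<epsilon> * min (b1*b2/2) (b2/2) \<le> \<epsilon> * (b2/2)"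
        using \<epsilon> by (intro mult_left_mono; simp)+
      ultimately have "\<mu> \<le> \<epsilon> * (b1*b2/2)" "\<mu> \<le> \<epsilon> * (b2/2)" by linarith+
      then have "\<mu> * x\<^sup>2 \<le> \<epsilon> * (b1*b2/2) * x\<^sup>2" "\<mu> * y\<^sup>2 \<le> \<epsilon> * (b2/2) * y\<^sup>2" "\<mu> * z\<^sup>2 \<le> a * z\<^sup>2"
        by (intro mult_right_mono; simp add: \<mu>_def)+
      then show ?thesis by (simp add: algebra_simps)
    qed
    finally show "(2*b1*b2*x + \<epsilon>*b2*y) * y + (2*b2*y + \<epsilon>*(2*z + b2*x)) * (z - b1*x)
            + (2*z + 2*\<epsilon>*y) * (- b2*y - a*z) \<le> - \<mu> * ?N" .
  qed (use m assms \<epsilon> \<mu> in \<open>auto intro!: add_pos_pos\<close>)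
qed

text \<open>Up to the first time at which \<open>W\<close> reaches \<open>r\<close>, the assumption
  \<open>decr\<close> and nonnegativity make \<open>W\<close> nonincreasing, so its value there is
  at most \<open>W 0 < r\<close>, a contradiction. The differential inequality therefore holds at
  all times, and the integrating factor \<open>exp (\<gamma> * s)\<close> turns it into the
  estimate.\<close>

lemma exponential_decay_below_level:
  fixes W W' :: "real \<Rightarrow> real"
  assumes deriv: "\<And>t. t \<ge> 0 \<Longrightarrow> (W has_real_derivative W' t) (at t within {0..})"
    and nonneg: "\<And>t. t \<ge> 0 \<Longrightarrow> W t \<ge> 0"
    and decr: "\<And>t. t \<ge> 0 \<Longrightarrow> W t \<le> r \<Longrightarrow> W' t \<le> - \<gamma> * W t"
    and "\<gamma> > 0" "W 0 < r" "t \<ge> 0"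
  shows "W t \<le> W 0 * exp (- \<gamma> * t)"
proof -
  have cont: "continuous_on {0..} W"
    using DERIV_continuous_on deriv by (metis atLeast_iff)
  have deriv_at: "(W has_real_derivative W' s) (at s)" if "s > 0" for s
    using deriv[of s] that at_within_interior[of s "{0..}"] by (simp add: interior_real_atLeast)
  have below: "W s < r" if "s \<ge> 0" for s
  proof (rule ccontr)
    assume "\<not> W s < r"
    define T where "T = {u \<in> {0..s}. r \<le> W u}"
    have "closed T"
      unfolding T_def
      by (intro continuous_on_closed_Collect_le continuous_on_subset[OF cont]) auto
    then have "compact ({0..s} \<inter> T)"
      by (intro compact_Int_closed) auto
    moreover have "{0..s} \<inter> T = T" "T \<noteq> {}"
      using \<open>\<not> W s < r\<close> that by (auto simp: T_def)
    ultimately obtain u where u: "u \<in> T" "\<And>y. y \<in> T \<Longrightarrow> u \<le> y"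
      using compact_attains_inf[of T] by auto
    have "W u \<le> W 0"
    proof (rule DERIV_nonpos_imp_decreasing_open[where f=W])
      show "0 \<le> u" using u by (auto simp: T_def)
      fix y assume y: "0 < y" "y < u"
      then have "y \<notin> T" using u(2)[of y] by auto
      then have "W y \<le> r" using y u(1) by (auto simp: T_def)
      moreover have "\<gamma> * W y \<ge> 0" using nonneg[of y] y \<open>\<gamma> > 0\<close> by simp
      ultimately have "W' y \<le> 0" using decr[of y] y by linarith
      then show "\<exists>D. (W has_real_derivative D) (at y) \<and> D \<le> 0"
        using deriv_at y by blast
    qed (auto intro!: continuous_on_subset[OF cont])
    then show False using u(1) \<open>W 0 < r\<close> by (simp add: T_def)
  qed
  let ?E = "\<lambda>s. W s * exp (\<gamma> * s)"
  have "?E t \<le> ?E 0"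
  proof (rule DERIV_nonpos_imp_decreasing_open[OF \<open>t \<ge> 0\<close>])
    fix s assume s: "0 < s" "s < t"
    have "(?E has_real_derivative (W' s + \<gamma> * W s) * exp (\<gamma> * s)) (at s)"
      using s by (auto intro!: derivative_eq_intros deriv_at simp: algebra_simps)
    moreover have "(W' s + \<gamma> * W s) * exp (\<gamma> * s) \<le> 0"
      using decr[of s] below[of s] s by (intro mult_nonpos_nonneg) auto
    ultimately show "\<exists>y. (?E has_real_derivative y) (at s) \<and> y \<le> 0" by blast
  qed (auto intro!: continuous_intros continuous_on_subset[OF cont])
  then show ?thesis by (simp add: exp_minus field_simps)
qed

text \<open>Quadratic perturbations change the derivative of the Lyapunov function only by cubic
  terms, which near the origin cost at most half of the negative quadratic part. The constants are
  obtained before the trajectory, so the estimate is uniform over all solutions and all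
  perturbations with the same \<open>C\<close>.\<close>

lemma perturbed_schwarz_decay:
  fixes a b1 b2 C :: real
  assumes "a > 0" "b1 > 0" "b2 > 0" "C \<ge> 0"
  obtains r B \<gamma> where "r > 0" "B > 0" "\<gamma> > 0"
    and "\<And>x y z f g t.
      \<lbrakk>\<And>t. t \<ge> 0 \<Longrightarrow> (x has_real_derivative y t) (at t within {0..});
       \<And>t. t \<ge> 0 \<Longrightarrow> (y has_real_derivative z t - b1 * x t + f t) (at t within {0..});
       \<And>t. t \<ge> 0 \<Longrightarrow> (z has_real_derivative - b2 * y t - a * z t + g t) (at t within {0..});
       \<And>t. t \<ge> 0 \<Longrightarrow> \<bar>f t\<bar> \<le> C * ((x t)\<^sup>2 + (y t)\<^sup>2 + (z t)\<^sup>2);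
       \<And>t. t \<ge> 0 \<Longrightarrow> \<bar>g t\<bar> \<le> C * ((x t)\<^sup>2 + (y t)\<^sup>2 + (z t)\<^sup>2);
       (x 0)\<^sup>2 + (y 0)\<^sup>2 + (z 0)\<^sup>2 < r; t \<ge> 0\<rbrakk>
      \<Longrightarrow> (x t)\<^sup>2 + (y t)\<^sup>2 + (z t)\<^sup>2 \<le> B * exp (- \<gamma> * t) * ((x 0)\<^sup>2 + (y 0)\<^sup>2 + (z 0)\<^sup>2)"
proof -
  obtain \<epsilon> m M \<mu> where pos: "\<epsilon> > 0" "m > 0" "M > 0" "\<mu> > 0"
    and lower: "\<And>x y z. m * (x\<^sup>2 + y\<^sup>2 + z\<^sup>2) \<le> b1*b2*x\<^sup>2 + b2*y\<^sup>2 + z\<^sup>2 + \<epsilon> * (2*y*z + b2*x*y)"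
    and upper: "\<And>x y z. b1*b2*x\<^sup>2 + b2*y\<^sup>2 + z\<^sup>2 + \<epsilon> * (2*y*z + b2*x*y) \<le> M * (x\<^sup>2 + y\<^sup>2 + z\<^sup>2)"
    and linear: "\<And>x y z. (2*b1*b2*x + \<epsilon>*b2*y) * y + (2*b2*y + \<epsilon>*(2*z + b2*x)) * (z - b1*x)
            + (2*z + 2*\<epsilon>*y) * (- b2*y - a*z) \<le> - \<mu> * (x\<^sup>2 + y\<^sup>2 + z\<^sup>2)"
    using schwarz_lyapunov[OF assms(1-3)] by metis
  \<comment> \<open>\<open>L\<close> times the norm bounds both partial derivatives of
    \<open>W\<close> that meet a perturbation, those in \<open>y\<close> and in \<open>z\<close>.
    Within radius \<open>s\<close> the cubic terms stay below \<open>\<mu>/2\<close> times the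
    squared norm; the \<open>+ 1\<close> keeps the denominator positive for \<open>C = 0\<close>.
    With \<open>\<rho> = m * s\<^sup>2\<close>, the sublevel set \<open>W \<le> \<rho>\<close> lies
    in that ball.\<close>
  define L where "L = 2*b2 + \<epsilon>*(2 + b2) + 2 + 2*\<epsilon>"
  define s where "s = \<mu> / (4*L*C + 1)"
  define \<rho> where "\<rho> = m * s\<^sup>2"
  have L: "L > 0" unfolding L_def using pos assms by (intro add_pos_pos mult_pos_pos) auto
  then have denom: "4*L*C + 1 > 0" using assms by (simp add: add_nonneg_pos)
  then have s: "s > 0" using pos by (simp add: s_def)
  have "s * (4*L*C + 1) = \<mu>" using denom by (simp add: s_def)
  then have sL: "2*L*C * s \<le> \<mu>/2" using s by (simp add: algebra_simps)
  show ?thesis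
  \<comment> \<open>The upper bound \<open>W \<le> M * ?N\<close> makes \<open>\<rho>/M\<close> a
    sufficient initial radius and turns the remaining dissipation \<open>\<mu>/2 * ?N\<close> into
    the rate \<open>\<mu>/(2*M)\<close>. The lower bound contributes \<open>1/m\<close> to the
    overshoot.\<close>
  proof (rule that[of "\<rho>/M" "M/m" "\<mu>/(2*M)"])
    fix x y z f g :: "real \<Rightarrow> real" and t :: real
    let ?N = "\<lambda>t. (x t)\<^sup>2 + (y t)\<^sup>2 + (z t)\<^sup>2"
    assume dx: "\<And>t. t \<ge> 0 \<Longrightarrow> (x has_real_derivative y t) (at t within {0..})"
      and dy: "\<And>t. t \<ge> 0 \<Longrightarrow> (y has_real_derivative z t - b1 * x t + f t) (at t within {0..})"
      and dz: "\<And>t. t \<ge> 0 \<Longrightarrow> (z has_real_derivative - b2 * y t - a * z t + g t) (at t within {0..})"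
      and f: "\<And>t. t \<ge> 0 \<Longrightarrow> \<bar>f t\<bar> \<le> C * ?N t"
      and g: "\<And>t. t \<ge> 0 \<Longrightarrow> \<bar>g t\<bar> \<le> C * ?N t"
      and N0: "?N 0 < \<rho>/M" and t: "t \<ge> 0"
    define W where "W = (\<lambda>t. b1*b2*(x t)\<^sup>2 + b2*(y t)\<^sup>2 + (z t)\<^sup>2 + \<epsilon> * (2*y t*z t + b2*x t*y t))"
    define W' where "W' = (\<lambda>t. (2*b1*b2*x t + \<epsilon>*b2*y t) * y t
        + (2*b2*y t + \<epsilon>*(2*z t + b2*x t)) * (z t - b1*x t + f t)
        + (2*z t + 2*\<epsilon>*y t) * (- b2*y t - a*z t + g t))"
    have W: "m * ?N u \<le> W u" "W u \<le> M * ?N u" for u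
      using lower upper by (auto simp: W_def)
    have "W t \<le> W 0 * exp (- (\<mu>/(2*M)) * t)"
    proof (rule exponential_decay_below_level)
      fix u :: real assume u: "u \<ge> 0"
      show "(W has_real_derivative W' u) (at u within {0..})"
        unfolding W_def W'_def
        by (rule derivative_eq_intros dx[OF u] dy[OF u] dz[OF u] refl)+ (simp add: algebra_simps)
      show "W u \<ge> 0" using order_trans[OF _ W(1)[of u]] pos by simp
      assume "W u \<le> \<rho>"
      with W(1)[of u] pos have "?N u \<le> s\<^sup>2" unfolding \<rho>_def
        by (metis mult_le_cancel_left_pos order_trans)
      then have Ns: "sqrt (?N u) \<le> s" using s by (simp add: real_le_lsqrt)
      have x: "\<bar>x u\<bar> \<le> sqrt (?N u)" and y: "\<bar>y u\<bar> \<le> sqrt (?N u)" and z: "\<bar>z u\<bar> \<le> sqrt (?N u)"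
        by (auto intro!: real_le_rsqrt)
      let ?n = "sqrt (?N u)"
      have "\<bar>2*b2*y u + \<epsilon>*(2*z u + b2*x u)\<bar> \<le> \<bar>2*b2*y u\<bar> + \<bar>\<epsilon>*(2*z u)\<bar> + \<bar>\<epsilon>*(b2*x u)\<bar>"
        unfolding distrib_left by linarith
      also have "\<dots> = 2*b2*\<bar>y u\<bar> + \<epsilon>*(2*\<bar>z u\<bar>) + \<epsilon>*(b2*\<bar>x u\<bar>)"
        using pos assms by (simp add: abs_mult)
      also have "\<dots> \<le> 2*b2*?n + \<epsilon>*(2*?n) + \<epsilon>*(b2*?n)"
        using pos assms x y z by (intro add_mono mult_left_mono) auto
      also have "\<dots> \<le> L * ?n"
        using pos by (simp add: L_def algebra_simps)
      finally have dyW: "\<bar>2*b2*y u + \<epsilon>*(2*z u + b2*x u)\<bar> \<le> L * ?n" .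
      have "\<bar>2*z u + 2*\<epsilon>*y u\<bar> \<le> 2*\<bar>z u\<bar> + 2*\<epsilon>*\<bar>y u\<bar>"
        using pos abs_triangle_ineq[of "2*z u" "2*\<epsilon>*y u"] by (simp add: abs_mult)
      also have "\<dots> \<le> 2*?n + 2*\<epsilon>*?n"
        using pos y z by (intro add_mono mult_left_mono) auto
      also have "\<dots> \<le> L * ?n"
        using pos assms by (simp add: L_def algebra_simps)
      finally have dzW: "\<bar>2*z u + 2*\<epsilon>*y u\<bar> \<le> L * ?n" .
      have prod_le: "p * q \<le> P * Q" if "\<bar>p\<bar> \<le> P" "\<bar>q\<bar> \<le> Q" for p q P Q :: real
      proof -
        have "p * q \<le> \<bar>p\<bar> * \<bar>q\<bar>" by (metis abs_ge_self abs_mult)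
        also have "\<dots> \<le> P * Q" using that by (intro mult_mono') auto
        finally show ?thesis .
      qed
      have "(2*b2*y u + \<epsilon>*(2*z u + b2*x u)) * f u \<le> (L * ?n) * (C * ?N u)"
        by (rule prod_le[OF dyW f[OF u]])
      moreover have "(2*z u + 2*\<epsilon>*y u) * g u \<le> (L * ?n) * (C * ?N u)"
        by (rule prod_le[OF dzW g[OF u]])
      moreover have "W' u \<le> - \<mu> * ?N u + (2*b2*y u + \<epsilon>*(2*z u + b2*x u)) * f u + (2*z u + 2*\<epsilon>*y u) * g u"
        using linear[of "x u" "y u" "z u"] unfolding W'_def by (simp add: algebra_simps)
      moreover have "2 * ((L * ?n) * (C * ?N u)) \<le> \<mu>/2 * ?N u"
      proof -
        have "2*L*C*?n \<le> 2*L*C * s" using Ns L assms by (intro mult_left_mono) auto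
        with sL have "2*L*C*?n \<le> \<mu>/2" by linarith
        then have "2*L*C*?n * ?N u \<le> \<mu>/2 * ?N u" by (intro mult_right_mono) auto
        then show ?thesis by (simp only: mult_ac)
      qed
      ultimately have "W' u \<le> - \<mu>/2 * ?N u" by simp
      also have "\<dots> = - (\<mu>/(2*M)) * (M * ?N u)" using pos by simp
      also have "\<dots> \<le> - (\<mu>/(2*M)) * W u"
        using W(2)[of u] pos by (intro mult_left_mono_neg) auto
      finally show "W' u \<le> - (\<mu>/(2*M)) * W u" .
    next
      show "W 0 < \<rho>" using W(2)[of 0] N0 pos by (simp add: pos_less_divide_eq mult.commute)
    qed (use pos t in auto)
    also have "\<dots> \<le> M * ?N 0 * exp (- (\<mu>/(2*M)) * t)"
      using W(2)[of 0] by (intro mult_right_mono) auto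
    finally have "m * ?N t \<le> M * ?N 0 * exp (- (\<mu>/(2*M)) * t)"
      using W(1)[of t] by linarith
    then show "?N t \<le> M/m * exp (- (\<mu>/(2*M)) * t) * ?N 0"
      using pos by (simp add: field_simps)
  qed (use pos s in \<open>auto simp: \<rho>_def\<close>)
qed

section \<open>The quadratic error system and its Schwarz coordinates\<close>

text \<open>Cauchy-Schwarz in three dimensions, from Lagrange's identity. It compares squared norms
  before and after a linear change of coordinates.\<close>

lemma linear_form_square_bound:
  fixes a b c x y z :: real
  shows "(a*x + b*y + c*z)\<^sup>2 \<le> (a\<^sup>2 + b\<^sup>2 + c\<^sup>2) * (x\<^sup>2 + y\<^sup>2 + z\<^sup>2)"
proof -
  have "(a\<^sup>2 + b\<^sup>2 + c\<^sup>2) * (x\<^sup>2 + y\<^sup>2 + z\<^sup>2) - (a*x + b*y + c*z)\<^sup>2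
      = (a*y - b*x)\<^sup>2 + (a*z - c*x)\<^sup>2 + (b*z - c*y)\<^sup>2"
    by (simp add: power2_eq_square algebra_simps)
  also have "\<dots> \<ge> 0" by simp
  finally show ?thesis by simp
qed

text \<open>An invertible linear change of coordinates brings the linear part to Schwarz form with
  damping \<open>d\<close>, and the quadratic terms fit \<open>perturbed_schwarz_decay\<close>. The
  Routh-Hurwitz assumption is what makes \<open>b2\<close> positive.\<close>

lemma body_frame_error_decay:
  fixes \<omega>0 v1 v2 kP kI :: real
  assumes pos: "\<omega>0 > 0" "v1 > 0" "kP > 0" "kI > 0"
    and hurwitz: "\<omega>0 * v1 + v2 * (kP * v1 + kI) > 0"
  obtains r B \<gamma> where "r > 0" "B > 0" "\<gamma> > 0"
    and "\<And>z1 z2 w t.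
      \<lbrakk>\<And>t. t \<ge> 0 \<Longrightarrow> (z1 has_real_derivative (\<omega>0 + w t) * z2 t - w t * v1 / \<omega>0) (at t within {0..});
       \<And>t. t \<ge> 0 \<Longrightarrow> (z2 has_real_derivative - (\<omega>0 + w t) * z1 t - w t * v2 / \<omega>0) (at t within {0..});
       \<And>t. t \<ge> 0 \<Longrightarrow> (w has_real_derivative
          kP * \<omega>0 * ((\<omega>0 + w t) * z2 t - w t * v1 / \<omega>0) - kI * w t) (at t within {0..});
       (z1 0)\<^sup>2 + (z2 0)\<^sup>2 + (w 0)\<^sup>2 < r; t \<ge> 0\<rbrakk>
      \<Longrightarrow> (z1 t)\<^sup>2 + (z2 t)\<^sup>2 + (w t)\<^sup>2 \<le> B * exp (- \<gamma> * t) * ((z1 0)\<^sup>2 + (z2 0)\<^sup>2 + (w 0)\<^sup>2)"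
proof -
  define d where "d = kP * v1 + kI"
  \<comment> \<open>The Schwarz form has characteristic polynomial \<open>\<lambda>\<^sup>3 +
    d*\<lambda>\<^sup>2 + (b1 + b2)*\<lambda> + d*b1\<close>; comparing the constant and linear
    coefficients with those of the error system determines \<open>b1\<close> and
    \<open>b2\<close>.\<close>
  define b1 where "b1 = \<omega>0\<^sup>2 * kI / d"
  define b2 where "b2 = kP * \<omega>0 * (\<omega>0 * v1 + v2 * d) / d"
  \<comment> \<open>\<open>R\<close> bounds the inverse change of coordinates and \<open>P\<close>
    the direct one: a Cauchy-Schwarz constant for each of the two transformed coordinates, and
    \<open>+ 1\<close> for \<open>w\<close>, which both systems share. \<open>C\<close> adds up the
    coefficients in \<open>f\<close> and \<open>g\<close>, with \<open>R\<close> expressing the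
    products \<open>w*z1\<close> and \<open>w*z2\<close> in the new norm.\<close>
  define R where "R = ((kI / (kP*\<omega>0))\<^sup>2 + (1 / (kP*\<omega>0))\<^sup>2 + 0\<^sup>2)
    + ((- b1 / (kP*\<omega>0\<^sup>2))\<^sup>2 + (d / (kP*\<omega>0\<^sup>2))\<^sup>2 + (1 / (kP*\<omega>0\<^sup>2))\<^sup>2) + 1"
  define P where "P = ((kP*\<omega>0/kI)\<^sup>2 + 0\<^sup>2 + (- 1/kI)\<^sup>2)
    + ((b1*kP*\<omega>0/kI)\<^sup>2 + (kP*\<omega>0\<^sup>2)\<^sup>2 + (- d - b1/kI)\<^sup>2) + 1"
  define C where "C = (kP*\<omega>0 + kP*\<omega>0\<^sup>2 + d*kP*\<omega>0) * R"
  have d: "d > 0" unfolding d_def using pos by (intro add_pos_pos mult_pos_pos)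
  have b1: "b1 > 0" using pos d by (simp add: b1_def)
  have b2: "b2 > 0" using pos d hurwitz by (simp add: b2_def d_def)
  have R: "R > 0" unfolding R_def by (intro add_nonneg_pos) auto
  have P: "P > 0" unfolding P_def by (intro add_nonneg_pos) auto
  have C: "C \<ge> 0" unfolding C_def using pos d R by (intro mult_nonneg_nonneg add_nonneg_nonneg) auto
  obtain r B \<gamma> where rB: "r > 0" "B > 0" "\<gamma> > 0"
    and decay: "\<And>x y z f g t.
      \<lbrakk>\<And>t. t \<ge> 0 \<Longrightarrow> (x has_real_derivative y t) (at t within {0..});
       \<And>t. t \<ge> 0 \<Longrightarrow> (y has_real_derivative z t - b1 * x t + f t) (at t within {0..});
       \<And>t. t \<ge> 0 \<Longrightarrow> (z has_real_derivative - b2 * y t - d * z t + g t) (at t within {0..});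
       \<And>t. t \<ge> 0 \<Longrightarrow> \<bar>f t\<bar> \<le> C * ((x t)\<^sup>2 + (y t)\<^sup>2 + (z t)\<^sup>2);
       \<And>t. t \<ge> 0 \<Longrightarrow> \<bar>g t\<bar> \<le> C * ((x t)\<^sup>2 + (y t)\<^sup>2 + (z t)\<^sup>2);
       (x 0)\<^sup>2 + (y 0)\<^sup>2 + (z 0)\<^sup>2 < r; t \<ge> 0\<rbrakk>
      \<Longrightarrow> (x t)\<^sup>2 + (y t)\<^sup>2 + (z t)\<^sup>2 \<le> B * exp (- \<gamma> * t) * ((x 0)\<^sup>2 + (y 0)\<^sup>2 + (z 0)\<^sup>2)"
    by (rule perturbed_schwarz_decay[OF d b1 b2 C]) blast
  show ?thesis
  proof (rule that[of "r/P" "R*B*P" \<gamma>])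
    fix z1 z2 w :: "real \<Rightarrow> real" and t :: real
    assume d1: "\<And>t. t \<ge> 0 \<Longrightarrow> (z1 has_real_derivative (\<omega>0 + w t) * z2 t - w t * v1 / \<omega>0) (at t within {0..})"
      and d2: "\<And>t. t \<ge> 0 \<Longrightarrow> (z2 has_real_derivative - (\<omega>0 + w t) * z1 t - w t * v2 / \<omega>0) (at t within {0..})"
      and dw: "\<And>t. t \<ge> 0 \<Longrightarrow> (w has_real_derivative
          kP * \<omega>0 * ((\<omega>0 + w t) * z2 t - w t * v1 / \<omega>0) - kI * w t) (at t within {0..})"
      and init: "(z1 0)\<^sup>2 + (z2 0)\<^sup>2 + (w 0)\<^sup>2 < r/P" and t: "t \<ge> 0"
    \<comment> \<open>By the integrator, \<open>x' = w\<close> holds exactly; then \<open>z\<close> is the linear part of \<open>w' + b1 * x\<close>, and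
      \<open>f\<close>, \<open>g\<close> collect the quadratic terms.\<close>
    define x where "x = (\<lambda>t. (kP*\<omega>0*z1 t - w t) / kI)"
    define z where "z = (\<lambda>t. kP*\<omega>0\<^sup>2*z2 t - d*w t + b1*x t)"
    define f where "f = (\<lambda>t. kP*\<omega>0*(w t*z2 t))"
    define g where "g = (\<lambda>t. - (kP*\<omega>0\<^sup>2*(w t*z1 t)) - d*kP*\<omega>0*(w t*z2 t))"
    let ?n = "\<lambda>t. (z1 t)\<^sup>2 + (z2 t)\<^sup>2 + (w t)\<^sup>2"
    let ?N = "\<lambda>t. (x t)\<^sup>2 + (w t)\<^sup>2 + (z t)\<^sup>2"
    have nN: "?n u \<le> R * ?N u" for u
    proof -
      have eq1: "z1 u = kI/(kP*\<omega>0) * x u + 1/(kP*\<omega>0) * w u + 0 * z u"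
        using pos by (simp add: x_def field_simps)
      have eq2: "z2 u = - b1/(kP*\<omega>0\<^sup>2) * x u + d/(kP*\<omega>0\<^sup>2) * w u + 1/(kP*\<omega>0\<^sup>2) * z u"
        using pos by (simp add: z_def field_simps)
      have "(w u)\<^sup>2 \<le> 1 * ?N u" by simp
      then show ?thesis
        unfolding R_def distrib_right[of _ _ "?N u"]
        using linear_form_square_bound[of "kI/(kP*\<omega>0)" "x u" "1/(kP*\<omega>0)" "w u" 0 "z u"]
          linear_form_square_bound[of "- b1/(kP*\<omega>0\<^sup>2)" "x u" "d/(kP*\<omega>0\<^sup>2)" "w u" "1/(kP*\<omega>0\<^sup>2)" "z u"]
        unfolding eq1[symmetric] eq2[symmetric] by (simp only: distrib_right)
    qed
    have Nn: "?N u \<le> P * ?n u" for u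
    proof -
      have eq1: "x u = kP*\<omega>0/kI * z1 u + 0 * z2 u + - 1/kI * w u"
        using pos by (simp add: x_def field_simps)
      have eq2: "z u = b1*kP*\<omega>0/kI * z1 u + kP*\<omega>0\<^sup>2 * z2 u + (- d - b1/kI) * w u"
        using pos by (simp add: z_def x_def field_simps)
      have "(w u)\<^sup>2 \<le> 1 * ?n u" by simp
      then show ?thesis
        unfolding P_def distrib_right[of _ _ "?n u"]
        using linear_form_square_bound[of "kP*\<omega>0/kI" "z1 u" 0 "z2 u" "- 1/kI" "w u"]
          linear_form_square_bound[of "b1*kP*\<omega>0/kI" "z1 u" "kP*\<omega>0\<^sup>2" "z2 u" "- d - b1/kI" "w u"]
        unfolding eq1[symmetric] eq2[symmetric] by (simp only: distrib_right)
    qed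
    have wz: "\<bar>w u * z1 u\<bar> \<le> R * ?N u" "\<bar>w u * z2 u\<bar> \<le> R * ?N u" for u
    proof -
      have "\<bar>p * q\<bar> \<le> p\<^sup>2 + q\<^sup>2" for p q :: real
        using sum_squares_bound[of "\<bar>p\<bar>" "\<bar>q\<bar>"] abs_ge_zero[of "p * q"]
        unfolding abs_mult power2_abs by linarith
      from this[of "w u" "z1 u"] this[of "w u" "z2 u"]
      show "\<bar>w u * z1 u\<bar> \<le> R * ?N u" "\<bar>w u * z2 u\<bar> \<le> R * ?N u"
        using nN[of u] zero_le_power2[of "z1 u"] zero_le_power2[of "z2 u"] by linarith+
    qed
    have "?N t \<le> B * exp (- \<gamma> * t) * ?N 0"
    proof (rule decay)
      fix u :: real assume u: "u \<ge> 0"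
      show "(x has_real_derivative w u) (at u within {0..})"
        unfolding x_def
        by (rule derivative_eq_intros d1[OF u] dw[OF u] refl)+ (use pos in \<open>simp_all add: field_simps\<close>)
      note dx = this
      show "(w has_real_derivative z u - b1 * x u + f u) (at u within {0..})"
        using dw[OF u] by (rule DERIV_cong)
          (use pos in \<open>simp add: z_def f_def d_def field_simps power2_eq_square\<close>)
      \<comment> \<open>This identity cancels the \<open>x\<close> term in the derivative of
        \<open>z\<close>; \<open>b2'\<close> then identifies the coefficient of
        \<open>w\<close>.\<close>
      have b1d: "b1 * d = \<omega>0\<^sup>2 * kI" using d by (simp add: b1_def)
      have "d * b2 = kP * \<omega>0 * (\<omega>0 * v1 + v2 * d)" using d by (simp add: b2_def)
      also have "\<dots> = \<omega>0\<^sup>2 * d + kP*\<omega>0* v2 * d - b1 * d"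
        unfolding b1d by (simp add: d_def power2_eq_square algebra_simps)
      also have "\<dots> = d * (\<omega>0\<^sup>2 + kP*\<omega>0* v2 - b1)" by (simp add: algebra_simps)
      finally have b2': "b2 = \<omega>0\<^sup>2 + kP*\<omega>0* v2 - b1" using d by simp
      have kx: "kP*\<omega>0*z1 u = kI * x u + w u" using pos by (simp add: x_def)
      have "kP*\<omega>0\<^sup>2*(- (\<omega>0 + w u) * z1 u - w u * v2 / \<omega>0)
          - d*(kP * \<omega>0 * ((\<omega>0 + w u) * z2 u - w u * v1 / \<omega>0) - kI * w u) + b1*w u
        = - (\<omega>0\<^sup>2*(kP*\<omega>0*z1 u)) - kP*\<omega>0* v2*w u + b1*w u
          - d*(kP*\<omega>0\<^sup>2*z2 u - d*w u) + g u"
        using pos by (simp add: g_def d_def field_simps power2_eq_square)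
      also have "\<dots> = - b2 * w u - d * z u + (b1*d - \<omega>0\<^sup>2*kI) * x u + g u"
        unfolding kx b2' z_def by (simp add: algebra_simps)
      also have "\<dots> = - b2 * w u - d * z u + g u" by (simp add: b1d)
      finally have eq: "kP*\<omega>0\<^sup>2*(- (\<omega>0 + w u) * z1 u - w u * v2 / \<omega>0)
          - d*(kP * \<omega>0 * ((\<omega>0 + w u) * z2 u - w u * v1 / \<omega>0) - kI * w u) + b1*w u
        = - b2 * w u - d * z u + g u" .
      show "(z has_real_derivative - b2 * w u - d * z u + g u) (at u within {0..})"
        unfolding eq[symmetric] unfolding z_def
        by (intro DERIV_add DERIV_diff DERIV_cmult d2[OF u] dw[OF u] dx)
      have nn: "R * ?N u \<ge> 0" using R by simp
      have "\<bar>f u\<bar> = kP*\<omega>0 * \<bar>w u * z2 u\<bar>" using pos by (simp add: f_def abs_mult)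
      also have "\<dots> \<le> kP*\<omega>0 * (R * ?N u)" using pos wz(2) by (intro mult_left_mono) auto
      also have "\<dots> \<le> (kP*\<omega>0 + kP*\<omega>0\<^sup>2 + d*kP*\<omega>0) * (R * ?N u)"
        using pos d nn by (intro mult_right_mono) auto
      finally show "\<bar>f u\<bar> \<le> C * ?N u" by (simp add: C_def mult.assoc)
      have "\<bar>g u\<bar> \<le> \<bar>kP*\<omega>0\<^sup>2 * (w u * z1 u)\<bar> + \<bar>d*kP*\<omega>0 * (w u * z2 u)\<bar>"
        unfolding g_def by linarith
      also have "\<dots> = kP*\<omega>0\<^sup>2 * \<bar>w u * z1 u\<bar> + d*kP*\<omega>0 * \<bar>w u * z2 u\<bar>"
        using pos d by (simp add: abs_mult)
      also have "\<dots> \<le> kP*\<omega>0\<^sup>2 * (R * ?N u) + d*kP*\<omega>0 * (R * ?N u)"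
        using pos d wz by (intro add_mono mult_left_mono) auto
      also have "\<dots> = (kP*\<omega>0\<^sup>2 + d*kP*\<omega>0) * (R * ?N u)" by (simp only: distrib_right)
      also have "\<dots> \<le> (kP*\<omega>0 + kP*\<omega>0\<^sup>2 + d*kP*\<omega>0) * (R * ?N u)"
        using pos nn by (intro mult_right_mono) auto
      finally show "\<bar>g u\<bar> \<le> C * ?N u" by (simp add: C_def mult.assoc)
    next
      show "?N 0 < r" using Nn[of 0] init P by (simp add: pos_less_divide_eq mult.commute)
    qed (rule t)
    also have "\<dots> \<le> B * exp (- \<gamma> * t) * (P * ?n 0)"
      using rB Nn[of 0] by (intro mult_left_mono) auto
    finally have "R * ?N t \<le> R * (B * exp (- \<gamma> * t) * (P * ?n 0))"
      using R by (intro mult_left_mono) auto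
    with nN[of t] show "?n t \<le> R*B*P * exp (- \<gamma> * t) * ?n 0"
      by (simp only: mult_ac)
  qed (use rB R P in auto)
qed

section \<open>Planar rotations, circle centers and the feedback in coordinates\<close>

text \<open>Orthogonal columns, a unit first column and determinant 1 force the second column to be
  the quarter turn of the first. All later computations can then be written in \<open>Q$1$1\<close>
  and \<open>Q$2$1\<close> alone.\<close>

lemma rotation_matrix_2_entries:
  fixes Q :: "real^2^2"
  assumes "rotation_matrix Q"
  shows "Q$1$2 = - Q$2$1" "Q$2$2 = Q$1$1" "(Q$1$1)\<^sup>2 + (Q$2$1)\<^sup>2 = 1"
proof -
  define a b c d where "a = Q$1$1" and "b = Q$1$2" and "c = Q$2$1" and "d = Q$2$2"
  note defs = a_def b_def c_def d_def
  have "transpose Q ** Q = mat 1" and det: "det Q = 1"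
    using assms by (auto simp: rotation_matrix_def orthogonal_matrix)
  then have "(transpose Q ** Q)$1$1 = 1" "(transpose Q ** Q)$1$2 = 0"
    by (auto simp: mat_def)
  then have n: "a\<^sup>2 + c\<^sup>2 = 1" and o: "a*b + c*d = 0"
    by (auto simp: defs matrix_matrix_mult_def transpose_def sum_2 power2_eq_square)
  have det: "a*d - b*c = 1" using det by (simp add: det_2 defs)
  \<comment> \<open>Both \<open>b + c\<close> and \<open>d - a\<close> are multiples of the inner
    product \<open>a*b + c*d\<close> of the columns, which is zero.\<close>
  have "b + c = b * (a\<^sup>2 + c\<^sup>2) + c * (a*d - b*c)" by (simp add: n det)
  also have "\<dots> = a * (a*b + c*d)" by (simp add: algebra_simps power2_eq_square)
  finally have "b = - c" by (simp add: o)
  have "d - a = d * (a\<^sup>2 + c\<^sup>2) - a * (a*d - b*c)" by (simp add: n det)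
  also have "\<dots> = c * (a*b + c*d)" by (simp add: algebra_simps power2_eq_square)
  finally have "d = a" by (simp add: o)
  show "Q$1$2 = - Q$2$1" "Q$2$2 = Q$1$1" "(Q$1$1)\<^sup>2 + (Q$2$1)\<^sup>2 = 1"
    using \<open>b = - c\<close> \<open>d = a\<close> n by (auto simp: defs)
qed

lemma has_vector_derivative_vec_nth:
  fixes f :: "real \<Rightarrow> ('a::real_normed_vector)^'n"
  assumes "(f has_vector_derivative f') F"
  shows "((\<lambda>t. f t $ i) has_vector_derivative f' $ i) F"
  using bounded_linear.has_vector_derivative[OF bounded_linear_vec_nth assms] .

lemma rot_half_pi_entries:
  "rot (pi/2) $ 1 $ 1 = 0" "rot (pi/2) $ 1 $ 2 = -1"
  "rot (pi/2) $ 2 $ 1 = 1" "rot (pi/2) $ 2 $ 2 = 0"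
  by (simp_all add: rot_def vector_2)

lemma e1_entries: "e1 $ 1 = 1" "e1 $ 2 = 0"
  by (simp_all add: e1_def axis_def)

lemma steered_motion_entries:
  assumes "steered_motion v \<omega> p Q" "t \<ge> 0"
  shows "((\<lambda>t. Q t $ 1 $ 1) has_real_derivative - \<omega> t * Q t $ 2 $ 1) (at t within {0..})"
    and "((\<lambda>t. Q t $ 2 $ 1) has_real_derivative \<omega> t * Q t $ 1 $ 1) (at t within {0..})"
    and "((\<lambda>t. p t $ 1) has_real_derivative Q t $ 1 $ 1 * v $ 1 - Q t $ 2 $ 1 * v $ 2) (at t within {0..})"
    and "((\<lambda>t. p t $ 2) has_real_derivative Q t $ 2 $ 1 * v $ 1 + Q t $ 1 $ 1 * v $ 2) (at t within {0..})"
proof -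
  have rm: "rotation_matrix (Q t)"
    and dQ: "(Q has_vector_derivative \<omega> t *\<^sub>R (Q t ** rot (pi/2))) (at t within {0..})"
    and dp: "(p has_vector_derivative Q t *v v) (at t within {0..})"
    using assms by (auto simp: steered_motion_def)
  note entries = matrix_matrix_mult_def matrix_vector_mult_def sum_2 rot_half_pi_entries
    rotation_matrix_2_entries[OF rm] has_real_derivative_iff_has_vector_derivative
  show "((\<lambda>t. Q t $ 1 $ 1) has_real_derivative - \<omega> t * Q t $ 2 $ 1) (at t within {0..})"
    using has_vector_derivative_vec_nth[OF has_vector_derivative_vec_nth[OF dQ], of 1 1]
    by (simp add: entries)
  show "((\<lambda>t. Q t $ 2 $ 1) has_real_derivative \<omega> t * Q t $ 1 $ 1) (at t within {0..})"
    using has_vector_derivative_vec_nth[OF has_vector_derivative_vec_nth[OF dQ], of 2 1]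
    by (simp add: entries)
  show "((\<lambda>t. p t $ 1) has_real_derivative Q t $ 1 $ 1 * v $ 1 - Q t $ 2 $ 1 * v $ 2) (at t within {0..})"
    using has_vector_derivative_vec_nth[OF dp, of 1] by (simp add: entries)
  show "((\<lambda>t. p t $ 2) has_real_derivative Q t $ 2 $ 1 * v $ 1 + Q t $ 1 $ 1 * v $ 2) (at t within {0..})"
    using has_vector_derivative_vec_nth[OF dp, of 2] by (simp add: entries)
qed

lemma circle_center_entries:
  assumes "rotation_matrix Q"
  shows "circle_center \<omega>0 v p Q $ 1 = p $ 1 - (Q $ 2 $ 1 * v $ 1 + Q $ 1 $ 1 * v $ 2) / \<omega>0"
    and "circle_center \<omega>0 v p Q $ 2 = p $ 2 + (Q $ 1 $ 1 * v $ 1 - Q $ 2 $ 1 * v $ 2) / \<omega>0"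
  by (simp_all add: circle_center_def matrix_matrix_mult_def matrix_vector_mult_def sum_2
      rot_half_pi_entries rotation_matrix_2_entries[OF assms] algebra_simps add_divide_distrib diff_divide_distrib)

text \<open>A quarter turn squares to \<open>-1\<close>, so the offset from \<open>p\<close> to the
  center has derivative \<open>- \<omega>/\<omega>0\<close> times the velocity
  \<open>Q *v v\<close>. Only the fraction \<open>1 - \<omega>/\<omega>0\<close> of the velocity
  remains, and the center rests when \<open>\<omega> = \<omega>0\<close>.\<close>

lemma circle_center_derivative:
  assumes "steered_motion v \<omega> p Q" "t \<ge> 0" "\<omega>0 \<noteq> 0"
  shows "((\<lambda>t. circle_center \<omega>0 v (p t) (Q t) $ 1) has_real_derivative
      (1 - \<omega> t / \<omega>0) * (Q t $ 1 $ 1 * v $ 1 - Q t $ 2 $ 1 * v $ 2)) (at t within {0..})"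
    and "((\<lambda>t. circle_center \<omega>0 v (p t) (Q t) $ 2) has_real_derivative
      (1 - \<omega> t / \<omega>0) * (Q t $ 2 $ 1 * v $ 1 + Q t $ 1 $ 1 * v $ 2)) (at t within {0..})"
proof -
  have rm: "rotation_matrix (Q s)" if "s \<in> {0..}" for s
    using assms that by (auto simp: steered_motion_def)
  note d = steered_motion_entries[OF assms(1,2)]
  have "((\<lambda>t. p t $ 1 - (Q t $ 2 $ 1 * v $ 1 + Q t $ 1 $ 1 * v $ 2) / \<omega>0) has_real_derivative
      (1 - \<omega> t / \<omega>0) * (Q t $ 1 $ 1 * v $ 1 - Q t $ 2 $ 1 * v $ 2)) (at t within {0..})"
    by (rule DERIV_cong[OF DERIV_diff[OF d(3) DERIV_cdivide[OF DERIV_add[OF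
          DERIV_cmult_right[OF d(2)] DERIV_cmult_right[OF d(1)]]]]])
       (use assms(3) in \<open>simp add: field_simps\<close>)
  \<comment> \<open>The entry formulas need \<open>Q\<close> to be a rotation, which is known for
    nonnegative times only; the derivative is therefore transferred within
    \<open>{0..}\<close>.\<close>
  then show "((\<lambda>t. circle_center \<omega>0 v (p t) (Q t) $ 1) has_real_derivative
      (1 - \<omega> t / \<omega>0) * (Q t $ 1 $ 1 * v $ 1 - Q t $ 2 $ 1 * v $ 2)) (at t within {0..})"
    by (rule has_field_derivative_transform_within[OF _ zero_less_one]) (use assms(2) in \<open>auto simp: circle_center_entries rm\<close>)
  have "((\<lambda>t. p t $ 2 + (Q t $ 1 $ 1 * v $ 1 - Q t $ 2 $ 1 * v $ 2) / \<omega>0) has_real_derivative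
      (1 - \<omega> t / \<omega>0) * (Q t $ 2 $ 1 * v $ 1 + Q t $ 1 $ 1 * v $ 2)) (at t within {0..})"
    by (rule DERIV_cong[OF DERIV_add[OF d(4) DERIV_cdivide[OF DERIV_diff[OF
          DERIV_cmult_right[OF d(1)] DERIV_cmult_right[OF d(2)]]]]])
       (use assms(3) in \<open>simp add: field_simps\<close>)
  then show "((\<lambda>t. circle_center \<omega>0 v (p t) (Q t) $ 2) has_real_derivative
      (1 - \<omega> t / \<omega>0) * (Q t $ 2 $ 1 * v $ 1 + Q t $ 1 $ 1 * v $ 2)) (at t within {0..})"
    by (rule has_field_derivative_transform_within[OF _ zero_less_one]) (use assms(2) in \<open>auto simp: circle_center_entries rm\<close>)
qed

text \<open>Planar rotations commute, so the second term of the feedback is the offset from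
  \<open>pr\<close> to the reference center, seen in the body frame. Replacing \<open>p\<close> by
  the vehicle's own center costs the first component of the quarter turn of \<open>v\<close>, hence
  the constant bias \<open>v $ 2\<close>, which the integrator has to compensate.\<close>

lemma \<omega>P_body_frame:
  assumes "rotation_matrix Q" "rotation_matrix Qr" "\<omega>0 \<noteq> 0"
  shows "\<omega>P \<omega>0 kP pr Qr p Q = kP * (\<omega>0 *
    (transpose Q *v (circle_center \<omega>0 v p Q - circle_center \<omega>0 e1 pr Qr)) $ 1 + v $ 2)"
proof -
  let ?q1 = "Q $ 1 $ 1" and ?q2 = "Q $ 2 $ 1" and ?r1 = "Qr $ 1 $ 1" and ?r2 = "Qr $ 2 $ 1"
  have "\<omega>P \<omega>0 kP pr Qr p Q =
      kP * (\<omega>0 * (?q1 * (p$1 - pr$1) + ?q2 * (p$2 - pr$2)) + ?q1 * ?r2 - ?q2 * ?r1)"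
    by (simp add: \<omega>P_def inner_vec_def matrix_matrix_mult_def matrix_vector_mult_def transpose_def
        sum_2 e1_entries rot_half_pi_entries rotation_matrix_2_entries[OF assms(1)]
        rotation_matrix_2_entries[OF assms(2)] algebra_simps)
  moreover have "\<omega>0 * (transpose Q *v (circle_center \<omega>0 v p Q - circle_center \<omega>0 e1 pr Qr)) $ 1
      = \<omega>0 * (?q1 * (p$1 - pr$1) + ?q2 * (p$2 - pr$2)) - (?q1\<^sup>2 + ?q2\<^sup>2) * v $ 2 + ?q1 * ?r2 - ?q2 * ?r1"
    using assms(3)
    by (simp add: matrix_vector_mult_def transpose_def sum_2 e1_entries
        circle_center_entries[OF assms(1)] circle_center_entries[OF assms(2)] field_simps power2_eq_square)
  ultimately show ?thesis by (simp add: rotation_matrix_2_entries[OF assms(1)])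
qed

section \<open>From the closed loop to stability of the target\<close>

text \<open>In the body frame the orientation drops out: the center moves with velocity
  \<open>- w/\<omega>0\<close> times \<open>v\<close>, and the turning frame adds a rotation at rate
  \<open>\<omega>0 + w\<close>. Using \<open>w\<close> in place of \<open>\<omega>I\<close> moves
  the equilibrium to the origin, since the constant bias disappears on differentiation.\<close>

lemma closed_loop_error_dynamics:
  fixes v :: "real^2"
  assumes "\<omega>0 > 0" and ref: "steered_motion e1 (\<lambda>t. \<omega>0) pr Qr"
    and cl: "closed_loop \<omega>0 v kP kI pr Qr p Q \<omega>I" and t: "t \<ge> 0"
  defines "\<zeta> \<equiv> \<lambda>t. transpose (Q t) *v (circle_center \<omega>0 v (p t) (Q t) - circle_center \<omega>0 e1 (pr t) (Qr t))"
    and "w \<equiv> \<lambda>t. \<omega>ctrl \<omega>0 kP kI (pr t) (Qr t) (p t) (Q t) (\<omega>I t) - \<omega>0"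
  shows "((\<lambda>t. \<zeta> t $ 1) has_real_derivative (\<omega>0 + w t) * \<zeta> t $ 2 - w t * v $ 1 / \<omega>0) (at t within {0..})"
    and "((\<lambda>t. \<zeta> t $ 2) has_real_derivative - (\<omega>0 + w t) * \<zeta> t $ 1 - w t * v $ 2 / \<omega>0) (at t within {0..})"
    and "(w has_real_derivative
      kP * \<omega>0 * ((\<omega>0 + w t) * \<zeta> t $ 2 - w t * v $ 1 / \<omega>0) - kI * w t) (at t within {0..})"
    and "(norm (circle_center \<omega>0 v (p t) (Q t) - circle_center \<omega>0 e1 (pr t) (Qr t)))\<^sup>2
      = (\<zeta> t $ 1)\<^sup>2 + (\<zeta> t $ 2)\<^sup>2"
proof -
  let ?D = "\<lambda>t. circle_center \<omega>0 v (p t) (Q t) - circle_center \<omega>0 e1 (pr t) (Qr t)"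
  let ?q1 = "\<lambda>t. Q t $ 1 $ 1" and ?q2 = "\<lambda>t. Q t $ 2 $ 1"
  have \<omega>0: "\<omega>0 \<noteq> 0" using assms(1) by simp
  have veh: "steered_motion v (\<lambda>t. \<omega>0 + w t) p Q"
    using cl by (simp add: closed_loop_def w_def)
  have rm: "rotation_matrix (Q s)" "rotation_matrix (Qr s)" if "s \<ge> 0" for s
    using veh ref that by (auto simp: steered_motion_def)
  note n = rotation_matrix_2_entries(3)[OF rm(1)[OF t]]
  have \<zeta>: "\<zeta> s $ 1 = ?q1 s * ?D s $ 1 + ?q2 s * ?D s $ 2" "\<zeta> s $ 2 = - ?q2 s * ?D s $ 1 + ?q1 s * ?D s $ 2"
    if "s \<ge> 0" for s
    using rotation_matrix_2_entries(1,2)[OF rm(1)[OF that]]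
    by (simp_all add: \<zeta>_def matrix_vector_mult_def transpose_def sum_2)
  have norm_D: "(norm (?D t))\<^sup>2 = (?D t $ 1)\<^sup>2 + (?D t $ 2)\<^sup>2"
    unfolding power2_norm_eq_inner by (simp add: inner_vec_def sum_2 power2_eq_square)
  have "(\<zeta> t $ 1)\<^sup>2 + (\<zeta> t $ 2)\<^sup>2 = (?q1 t ^ 2 + ?q2 t ^ 2) * ((?D t $ 1)\<^sup>2 + (?D t $ 2)\<^sup>2)"
    unfolding \<zeta>[OF t] by (simp add: power2_eq_square algebra_simps)
  with norm_D show "(norm (?D t))\<^sup>2 = (\<zeta> t $ 1)\<^sup>2 + (\<zeta> t $ 2)\<^sup>2"
    by (simp add: n)
  \<comment> \<open>The reference turns at exactly \<open>\<omega>0\<close>, so its center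
    contributes zero.\<close>
  have dD: "((\<lambda>t. ?D t $ 1) has_real_derivative - w t / \<omega>0 * (?q1 t * v $ 1 - ?q2 t * v $ 2)) (at t within {0..})"
    "((\<lambda>t. ?D t $ 2) has_real_derivative - w t / \<omega>0 * (?q2 t * v $ 1 + ?q1 t * v $ 2)) (at t within {0..})"
    using DERIV_diff[OF circle_center_derivative(1)[OF veh t \<omega>0] circle_center_derivative(1)[OF ref t \<omega>0]]
      DERIV_diff[OF circle_center_derivative(2)[OF veh t \<omega>0] circle_center_derivative(2)[OF ref t \<omega>0]] \<omega>0
    by (simp_all add: add_divide_distrib)
  note d = dD steered_motion_entries(1,2)[OF veh t]
  \<comment> \<open>The factor \<open>?q1 t ^ 2 + ?q2 t ^ 2\<close> stays unevaluated so that the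
    derivatives match by algebra alone; \<open>n\<close> replaces it by 1 afterwards.\<close>
  have "((\<lambda>t. ?q1 t * ?D t $ 1 + ?q2 t * ?D t $ 2) has_real_derivative
      (\<omega>0 + w t) * \<zeta> t $ 2 - w t * ((?q1 t ^ 2 + ?q2 t ^ 2) * v $ 1) / \<omega>0) (at t within {0..})"
    unfolding \<zeta>[OF t]
    by (rule DERIV_cong[OF DERIV_add[OF DERIV_mult[OF d(3,1)] DERIV_mult[OF d(4,2)]]])
       (use assms(1) in \<open>simp add: field_simps power2_eq_square\<close>)
  then show d\<zeta>1: "((\<lambda>t. \<zeta> t $ 1) has_real_derivative (\<omega>0 + w t) * \<zeta> t $ 2 - w t * v $ 1 / \<omega>0) (at t within {0..})"
    unfolding n by (simp only: mult_1) (rule has_field_derivative_transform_within[OF _ zero_less_one], use t \<zeta> in auto)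
  have "((\<lambda>t. - ?q2 t * ?D t $ 1 + ?q1 t * ?D t $ 2) has_real_derivative
      - (\<omega>0 + w t) * \<zeta> t $ 1 - w t * ((?q1 t ^ 2 + ?q2 t ^ 2) * v $ 2) / \<omega>0) (at t within {0..})"
    unfolding \<zeta>[OF t]
    by (rule DERIV_cong[OF DERIV_add[OF DERIV_mult[OF DERIV_minus[OF d(4)] d(1)] DERIV_mult[OF d(3,2)]]])
       (use assms(1) in \<open>simp add: field_simps power2_eq_square\<close>)
  then show "((\<lambda>t. \<zeta> t $ 2) has_real_derivative - (\<omega>0 + w t) * \<zeta> t $ 1 - w t * v $ 2 / \<omega>0) (at t within {0..})"
    unfolding n by (simp only: mult_1) (rule has_field_derivative_transform_within[OF _ zero_less_one], use t \<zeta> in auto)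
  have P: "\<omega>P \<omega>0 kP (pr s) (Qr s) (p s) (Q s) = kP * (\<omega>0 * \<zeta> s $ 1 + v $ 2)" if "s \<ge> 0" for s
    unfolding \<zeta>_def using \<omega>P_body_frame rm that assms(1) by simp
  have w: "w s = kP * (\<omega>0 * \<zeta> s $ 1 + v $ 2) - kI * \<omega>I s" if "s \<ge> 0" for s
    using P[OF that] by (simp add: w_def \<omega>ctrl_def)
  \<comment> \<open>The right-hand side of the integrator is \<open>\<omega> - \<omega>0\<close>,
    that is \<open>w\<close> itself; this closes the equation for \<open>w\<close>.\<close>
  have "(\<omega>I has_real_derivative w t) (at t within {0..})"
    using cl t unfolding closed_loop_def w[OF t] by (metis P[OF t])
  then have "((\<lambda>t. kP * (\<omega>0 * \<zeta> t $ 1 + v $ 2) - kI * \<omega>I t) has_real_derivative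
      kP * (\<omega>0 * ((\<omega>0 + w t) * \<zeta> t $ 2 - w t * v $ 1 / \<omega>0) + 0) - kI * w t) (at t within {0..})"
    by (intro DERIV_diff DERIV_cmult DERIV_add DERIV_const d\<zeta>1)
  then have "(w has_real_derivative
      kP * (\<omega>0 * ((\<omega>0 + w t) * \<zeta> t $ 2 - w t * v $ 1 / \<omega>0) + 0) - kI * w t) (at t within {0..})"
    by (rule has_field_derivative_transform_within[OF _ zero_less_one]) (use t in \<open>simp_all add: w\<close>)
  then show "(w has_real_derivative
      kP * \<omega>0 * ((\<omega>0 + w t) * \<zeta> t $ 2 - w t * v $ 1 / \<omega>0) - kI * w t) (at t within {0..})"
    by (simp only: add_0_right mult.assoc)
qed

text \<open>Each summand of \<open>dev\<close> is at most the root of the squared error norm, whence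
  the factor 2 in \<open>bound\<close>. That single exponential estimate yields both stability and
  attraction.\<close>

lemma target_stable_if_hurwitz:
  fixes v :: "real^2"
  assumes "\<omega>0 > 0" "v $ 1 > 0" "kP > 0" "kI > 0"
    and hurwitz: "\<omega>0 * v $ 1 + v $ 2 * (kP * v $ 1 + kI) > 0"
    and ref: "steered_motion e1 (\<lambda>t. \<omega>0) pr Qr"
  shows "target_locally_asymptotically_stable \<omega>0 v kP kI pr Qr"
proof -
  define D where "D = (\<lambda>p Q t. circle_center \<omega>0 v (p t) (Q t) - circle_center \<omega>0 e1 (pr t) (Qr t))"
  define w where "w = (\<lambda>p Q \<omega>I t. \<omega>ctrl \<omega>0 kP kI (pr t) (Qr t) (p t) (Q t) (\<omega>I t) - \<omega>0)"
  define dev where "dev = (\<lambda>p Q \<omega>I t. norm (D p Q t) + \<bar>w p Q \<omega>I t\<bar>)"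
  obtain r B \<gamma> where rB: "r > 0" "B > 0" "\<gamma> > 0"
    and decay: "\<And>z1 z2 w t.
      \<lbrakk>\<And>t. t \<ge> 0 \<Longrightarrow> (z1 has_real_derivative (\<omega>0 + w t) * z2 t - w t * v $ 1 / \<omega>0) (at t within {0..});
       \<And>t. t \<ge> 0 \<Longrightarrow> (z2 has_real_derivative - (\<omega>0 + w t) * z1 t - w t * v $ 2 / \<omega>0) (at t within {0..});
       \<And>t. t \<ge> 0 \<Longrightarrow> (w has_real_derivative
          kP * \<omega>0 * ((\<omega>0 + w t) * z2 t - w t * v $ 1 / \<omega>0) - kI * w t) (at t within {0..});
       (z1 0)\<^sup>2 + (z2 0)\<^sup>2 + (w 0)\<^sup>2 < r; t \<ge> 0\<rbrakk>
      \<Longrightarrow> (z1 t)\<^sup>2 + (z2 t)\<^sup>2 + (w t)\<^sup>2 \<le> B * exp (- \<gamma> * t) * ((z1 0)\<^sup>2 + (z2 0)\<^sup>2 + (w 0)\<^sup>2)"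
    using body_frame_error_decay[OF assms(1-4) hurwitz] by metis
  have bound: "dev p Q \<omega>I t \<le> 2 * sqrt (B * exp (- \<gamma> * t)) * dev p Q \<omega>I 0"
    if cl: "closed_loop \<omega>0 v kP kI pr Qr p Q \<omega>I" and small: "dev p Q \<omega>I 0 < sqrt r" and t: "t \<ge> 0"
    for p Q \<omega>I t
  proof -
    note dyn = closed_loop_error_dynamics[OF \<open>\<omega>0 > 0\<close> ref cl]
    define z1 where "z1 = (\<lambda>t. (transpose (Q t) *v D p Q t) $ 1)"
    define z2 where "z2 = (\<lambda>t. (transpose (Q t) *v D p Q t) $ 2)"
    let ?n = "\<lambda>t. (norm (D p Q t))\<^sup>2 + (w p Q \<omega>I t)\<^sup>2"
    have n: "?n s = (z1 s)\<^sup>2 + (z2 s)\<^sup>2 + (w p Q \<omega>I s)\<^sup>2" if "s \<ge> 0" for s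
      using dyn(4)[OF that] by (simp add: z1_def z2_def D_def)
    have dev0: "dev p Q \<omega>I 0 \<ge> 0" by (simp add: dev_def)
    have n0: "?n 0 \<le> (dev p Q \<omega>I 0)\<^sup>2"
      by (simp add: dev_def power2_sum)
    also have "\<dots> < r" using small dev0 by (metis rB(1) real_less_rsqrt real_sqrt_less_iff real_sqrt_abs abs_of_nonneg)
    finally have "?n 0 < r" .
    have "?n t \<le> B * exp (- \<gamma> * t) * ?n 0"
      unfolding n[OF t] n[OF order_refl]
    proof (rule decay)
      show "(z1 0)\<^sup>2 + (z2 0)\<^sup>2 + (w p Q \<omega>I 0)\<^sup>2 < r" using \<open>?n 0 < r\<close> n[of 0] by simp
    qed (use t dyn(1-3) in \<open>auto simp: z1_def z2_def w_def D_def\<close>)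
    also have "\<dots> \<le> B * exp (- \<gamma> * t) * (dev p Q \<omega>I 0)\<^sup>2"
      using n0 rB by (intro mult_left_mono) auto
    finally have "sqrt (?n t) \<le> sqrt (B * exp (- \<gamma> * t)) * dev p Q \<omega>I 0"
      using dev0 by (metis real_sqrt_le_mono real_sqrt_mult real_sqrt_abs abs_of_nonneg)
    moreover have "norm (D p Q t) \<le> sqrt (?n t)" "\<bar>w p Q \<omega>I t\<bar> \<le> sqrt (?n t)"
      by (auto intro!: real_le_rsqrt)
    moreover have "dev p Q \<omega>I t = norm (D p Q t) + \<bar>w p Q \<omega>I t\<bar>" by (simp add: dev_def)
    ultimately show ?thesis by linarith
  qed
  have "\<exists>\<eta>>0. \<forall>p Q \<omega>I. closed_loop \<omega>0 v kP kI pr Qr p Q \<omega>I \<longrightarrow>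
           dev p Q \<omega>I 0 < \<eta> \<longrightarrow> (\<forall>t\<ge>0. dev p Q \<omega>I t < \<delta>)" if "\<delta> > 0" for \<delta>
  \<comment> \<open>\<open>sqrt r\<close> keeps the initial error in the region of decay, and the
    second bound offsets the overshoot factor \<open>2 * sqrt B\<close>.\<close>
  proof (intro exI[of _ "min (sqrt r) (\<delta> / (2 * sqrt B))"] conjI allI impI)
    fix p Q \<omega>I and t :: real
    assume cl: "closed_loop \<omega>0 v kP kI pr Qr p Q \<omega>I"
      and small: "dev p Q \<omega>I 0 < min (sqrt r) (\<delta> / (2 * sqrt B))" and t: "t \<ge> 0"
    have "dev p Q \<omega>I t \<le> 2 * sqrt (B * exp (- \<gamma> * t)) * dev p Q \<omega>I 0"
      using bound[OF cl _ t] small by simp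
    also have "\<dots> \<le> 2 * sqrt B * dev p Q \<omega>I 0"
      using rB t by (intro mult_right_mono mult_left_mono real_sqrt_le_mono) (auto simp: dev_def)
    also have "\<dots> < \<delta>" using small rB by (simp add: field_simps)
    finally show "dev p Q \<omega>I t < \<delta>" .
  qed (use rB that in auto)
  moreover have "((D p Q) \<longlongrightarrow> 0) at_top \<and>
      ((\<lambda>t. \<omega>ctrl \<omega>0 kP kI (pr t) (Qr t) (p t) (Q t) (\<omega>I t)) \<longlongrightarrow> \<omega>0) at_top"
    if "closed_loop \<omega>0 v kP kI pr Qr p Q \<omega>I" "dev p Q \<omega>I 0 < sqrt r" for p Q \<omega>I
  proof -
    have ev: "\<forall>\<^sub>F t in at_top. dev p Q \<omega>I t \<le> 2 * sqrt (B * exp (- \<gamma> * t)) * dev p Q \<omega>I 0"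
      using eventually_ge_at_top[of 0] by eventually_elim (rule bound[OF that])
    have "((\<lambda>t. exp (- \<gamma> * t)) \<longlongrightarrow> 0) at_top"
      using rB(3)
      by (intro filterlim_compose[OF exp_at_bot] filterlim_tendsto_neg_mult_at_bot[OF tendsto_const] filterlim_ident) simp
    then have "((\<lambda>t. 2 * sqrt (B * exp (- \<gamma> * t)) * dev p Q \<omega>I 0) \<longlongrightarrow> 2 * sqrt (B * 0) * dev p Q \<omega>I 0) at_top"
      by (intro tendsto_intros)
    then have lim: "((\<lambda>t. 2 * sqrt (B * exp (- \<gamma> * t)) * dev p Q \<omega>I 0) \<longlongrightarrow> 0) at_top" by simp
    have "((D p Q) \<longlongrightarrow> 0) at_top"
      by (rule Lim_null_comparison[OF eventually_mono[OF ev] lim])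
        (erule order_trans[rotated], simp add: dev_def)
    moreover have "(w p Q \<omega>I \<longlongrightarrow> 0) at_top"
      by (rule Lim_null_comparison[OF eventually_mono[OF ev] lim])
        (erule order_trans[rotated], simp add: dev_def)
    ultimately show ?thesis by (simp add: w_def Lim_null[symmetric])
  qed
  ultimately show ?thesis
    unfolding target_locally_asymptotically_stable_def Let_def
    using rB by (auto simp: dev_def D_def w_def intro!: exI[of _ "sqrt r"])
qed

text \<open>"Small enough" is taken in the strong sense that all pairs of positive gains below a
  common threshold work. The threshold built in the proof depends only on \<open>\<omega>0\<close>
  and \<open>v\<close>.\<close>

theorem proposition4:
  fixes \<omega>0 speed \<phi> :: real
    and pr :: "real \<Rightarrow> real^2" and Qr :: "real \<Rightarrow> real^2^2"
  assumes "\<omega>0 > 0"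
    and "steered_motion e1 (\<lambda>t. \<omega>0) pr Qr"
    and "speed > 0"
    and "\<phi> \<in> {-(pi/2)<..<pi/2}"
  shows "\<exists>K>0. \<forall>kI kP. 0 < kI \<longrightarrow> kI < K \<longrightarrow> 0 < kP \<longrightarrow> kP < K \<longrightarrow>
    target_locally_asymptotically_stable \<omega>0 (speed *\<^sub>R (rot \<phi> *v e1)) kP kI pr Qr"
proof -
  define v where "v = speed *\<^sub>R (rot \<phi> *v e1)"
  \<comment> \<open>This component equals \<open>speed * cos \<phi>\<close>; the admissible range of
    \<open>\<phi>\<close> enters here.\<close>
  have v1: "v $ 1 > 0"
    using assms(3,4) cos_gt_zero_pi[of \<phi>]
    by (simp add: v_def matrix_vector_mult_def sum_2 rot_def e1_entries)
  \<comment> \<open>Solves \<open>(\<bar>v $ 2\<bar> + 1) * (K * (v $ 1 + 1)) = \<omega>0 * v $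
    1\<close>. Gains below \<open>K\<close> satisfy
    \<open>kP * v $ 1 + kI < K * (v $ 1 + 1)\<close>, and the \<open>+ 1\<close> next to
    \<open>\<bar>v $ 2\<bar>\<close> keeps the estimate meaningful when
    \<open>v $ 2 = 0\<close>.\<close>
  define K where "K = \<omega>0 * v $ 1 / ((\<bar>v $ 2\<bar> + 1) * (v $ 1 + 1))"
  have K: "K > 0" using v1 assms(1) by (simp add: K_def add_nonneg_pos)
  have "target_locally_asymptotically_stable \<omega>0 v kP kI pr Qr"
    if k: "0 < kI" "kI < K" "0 < kP" "kP < K" for kI kP
  proof (rule target_stable_if_hurwitz[OF assms(1) v1 k(3,1) _ assms(2)])
    have kK: "kP * v $ 1 + kI < K * (v $ 1 + 1)"
      using mult_strict_right_mono[OF k(4) v1] k(2) by (simp add: algebra_simps)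
    have k0: "kP * v $ 1 + kI > 0" using k v1 by (simp add: add_pos_pos)
    have "- (v $ 2 * (kP * v $ 1 + kI)) \<le> \<bar>v $ 2\<bar> * (kP * v $ 1 + kI)"
      using k0 mult_right_mono[of "- v $ 2" "\<bar>v $ 2\<bar>" "kP * v $ 1 + kI"] by simp
    also have "\<dots> < (\<bar>v $ 2\<bar> + 1) * (K * (v $ 1 + 1))"
      using kK k0 by (intro mult_strict_mono) auto
    also have "\<dots> = \<omega>0 * v $ 1"
      using v1 by (simp add: K_def add_nonneg_pos)
    finally show "\<omega>0 * v $ 1 + v $ 2 * (kP * v $ 1 + kI) > 0" by linarith
  qed
  with K show ?thesis unfolding v_def by blast
qed

end
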